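(* Let $K$ be a field, let $f$ be a monic irreducible separable quadratic polynomial over $K$, and let $E(f)$ be the vertex set of the corresponding quadratic extension graph. Then $E(f)$ consists of a single cluster, and distinct blocks in $E(f)$ have distinct discriminants. If $\mathrm{char}(K)\neq 2$, then the block graph of $E(f)$ is a complete graph (for any ordered pair $(\Theta,\Theta')$ of distinct blocks there is an arc from $\Theta$ to $\Theta'$), and the set of mappings $\mathcal F_b$, $0\neq b\in K$, forms a group of permutations of the set $\mathcal B$ of blocks of $E(f)$, isomorphic to the multiplicative group $(K^* )^2=\{k^2 : k\in K^*\}$. The isomorphism associates to $b^2\in (K^* )^2$ the permutation sending each block $\Theta$ to $\mathcal F_{b/2}(\Theta)$.
   Context: For monic irreducible separable polynomials $f,g$ over a field $K$, $f\wedge g$ denotes the minimal polynomial over $K$ of $f(\alpha)$, where $\alpha$ is a root of $g$ (independent of the choice of root). For a monic irreducible quadratic $f$ with root $\alpha$, $E(f)$ is the set of minimal polynomials over $K$ of all elements $\beta\in K(\alpha)$ with $K(\beta)=K(\alpha)$ (the vertex set of the extension graph). For $a,b\in K$, $a\ne0$, and $g$ monic irreducible over $K$ put $\sigma_{a,b}(g)(x)=a^{-\deg g}\,g(ax+b)$, and write $g_b^+(x)=\sigma_{1,b}(g)(x)=g(x+b)$. The cluster of $g$ is $\{\sigma_{a,b}(g): a,b\in K,\ a\neq0\}$ and the block of $g$ is $\Theta_g=\{g_b^+: b\in K\}$; clusters and blocks partition $E(f)$. All polynomials in a block have the same discriminant, called the discriminant of the block. $\mathcal B$ denotes the set of blocks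 of $E(f)$. For $\mathrm{char}(K)\neq2$ and $0\neq b\in K$, $\mathcal F_b:\mathcal B\to\mathcal B$ is the (well-defined) mapping $\Theta_g\mapsto\Theta_{g\wedge g_b^+}$. The block graph is the directed graph whose vertices are the blocks in $\mathcal B$, with an arc from $\Theta$ to $\Theta'$ whenever $\Theta'=\mathcal F_b(\Theta)$ for some $0\neq b\in K$. *)

theory Defs
  imports
    "Graph_Theory.Pair_Digraph"
    "HOL-Algebra.Bij"
    "HOL-Algebra.Generated_Fields"
    "HOL-Algebra.Algebraic_Closure_Type"
begin

text \<open>
  The field \<open>K\<close> is a type \<open>'a\<close> of class \<open>field\<close>; roots and extension fields of \<open>K\<close> live in
  its algebraic closure \<open>'a alg_closure\<close>, with embedding \<open>to_ac\<close>.

  Wherever a notion is defined through a choice of representative or root that does not matter,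
  we take \<open>the_elem\<close> of the set of the values at \<^emph>\<open>all\<close> choices. This is the common value if it
  is independent of the choice, and unspecified otherwise.
\<close>

definition roots_ac :: "'a::field poly \<Rightarrow> 'a alg_closure set" where
  "roots_ac p = {\<alpha>. poly (map_poly to_ac p) \<alpha> = 0}"

definition separable :: "'a::field poly \<Rightarrow> bool" where
  "separable p \<longleftrightarrow> rsquarefree (map_poly to_ac p)"

definition min_poly :: "'a::field alg_closure \<Rightarrow> 'a poly" where
  "min_poly \<beta> = (THE p. lead_coeff p = 1 \<and> \<beta> \<in> roots_ac p \<and>
                    (\<forall>q. q \<noteq> 0 \<and> \<beta> \<in> roots_ac q \<longrightarrow> degree p \<le> degree q))"

definition adjoin :: "'a::field alg_closure \<Rightarrow> 'a alg_closure set" where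
  "adjoin \<alpha> = generate_field ring_of_type_algebra (insert \<alpha> (range to_ac))"

definition wedge :: "'a::field poly \<Rightarrow> 'a poly \<Rightarrow> 'a poly" (infixl \<open>\<sqinter>\<^sub>p\<close> 70) where
  "f \<sqinter>\<^sub>p g = the_elem ((\<lambda>\<alpha>. min_poly (poly (map_poly to_ac f) \<alpha>)) ` roots_ac g)"

definition ext_vertices :: "'a::field poly \<Rightarrow> 'a poly set" where
  "ext_vertices f =
     the_elem ((\<lambda>\<alpha>. min_poly ` {\<beta> \<in> adjoin \<alpha>. adjoin \<beta> = adjoin \<alpha>}) ` roots_ac f)"

definition subst_affine :: "'a::field \<Rightarrow> 'a \<Rightarrow> 'a poly \<Rightarrow> 'a poly" where
  "subst_affine a b g = smult (inverse a ^ degree g) (pcompose g [:b, a:])"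

definition shift :: "'a::field \<Rightarrow> 'a poly \<Rightarrow> 'a poly" where
  "shift b g = subst_affine 1 b g"

definition cluster :: "'a::field poly \<Rightarrow> 'a poly set" where
  "cluster g = {subst_affine a b g | a b. a \<noteq> 0}"

definition block :: "'a::field poly \<Rightarrow> 'a poly set" where
  "block g = {shift b g | b. True}"

definition blocks :: "'a::field poly \<Rightarrow> 'a poly set set" where
  "blocks f = block ` ext_vertices f"

text \<open>Only applied to polynomials of degree 2.\<close>

definition quad_disc :: "'a::field poly \<Rightarrow> 'a" where
  "quad_disc p = (coeff p 1)\<^sup>2 - 4 * coeff p 2 * coeff p 0"

definition block_disc :: "'a::field poly set \<Rightarrow> 'a" where
  "block_disc \<Theta> = the_elem (quad_disc ` \<Theta>)"

text \<open>
  The mapping \<open>\<F>\<^sub>b\<close> on the blocks of \<open>E(f)\<close>. It is extensional (undefined outside \<open>blocks f\<close>), as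
  required of the elements of \<open>BijGroup (blocks f)\<close>.
\<close>

definition block_map :: "'a::field poly \<Rightarrow> 'a \<Rightarrow> 'a poly set \<Rightarrow> 'a poly set" where
  "block_map f b = (\<lambda>\<Theta>\<in>blocks f. the_elem ((\<lambda>g. block (g \<sqinter>\<^sub>p shift b g)) ` \<Theta>))"

text \<open>The block graph may have loops: \<open>\<F>\<^sub>b\<close> is the identity for \<open>b = 1/2\<close>.\<close>

definition block_graph :: "'a::field poly \<Rightarrow> 'a poly set pair_pre_digraph" where
  "block_graph f = \<lparr> pverts = blocks f,
                     parcs = {(\<Theta>, block_map f b \<Theta>) | \<Theta> b. \<Theta> \<in> blocks f \<and> b \<noteq> 0} \<rparr>"

definition square_group :: "'a::field monoid" where
  "square_group = \<lparr> carrier = {k\<^sup>2 | k. k \<noteq> 0}, monoid.mult = (*), one = 1 \<rparr>"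

end

theory Submission
  imports Defs
begin

text \<open>
  If \<open>\<alpha>\<close> is a root of \<open>f\<close>, then \<open>K(\<alpha>) = {u \<alpha> + v}\<close>, and its generators are the elements with
  \<open>u \<noteq> 0\<close>. The minimal polynomial of \<open>u \<alpha> + v\<close> is \<open>\<sigma>\<^bsub>1/u, -v/u\<^esub>(f)\<close>, so \<open>E(f)\<close> is the cluster of
  \<open>f\<close>. Its discriminant is \<open>u\<^sup>2\<close> times that of \<open>f\<close>, which determines \<open>u\<close> up to sign, and
  the sign does not change the block because the conjugate of \<open>\<alpha>\<close> is \<open>-\<alpha> - p\<close>. Finally, if \<open>\<alpha>\<close> is
  a root of a monic quadratic \<open>g\<close>, then \<open>\<alpha> - b\<close> is one of \<open>g\<^sub>b\<^sup>+\<close> and \<open>g(\<alpha> - b) = -2b\<alpha> + const\<close>.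
  Hence \<open>\<F>\<^sub>b\<close> multiplies the discriminants of the blocks, which identify the blocks, by \<open>(2b)\<^sup>2\<close>.
\<close>

section \<open>Evaluation in the algebraic closure\<close>

abbreviation eval_ac :: "'a::field poly \<Rightarrow> 'a alg_closure \<Rightarrow> 'a alg_closure" where
  "eval_ac g x \<equiv> poly (map_poly to_ac g) x"

lemma eval_ac_pCons [simp]: "eval_ac (pCons c g) x = to_ac c + x * eval_ac g x"
  by (simp add: map_poly_pCons)

lemma eval_ac_add [simp]: "eval_ac (g + h) x = eval_ac g x + eval_ac h x"
proof (induction g arbitrary: h)
  case (pCons c g)
  show ?case
    by (cases h) (simp only: add_pCons eval_ac_pCons pCons.IH to_ac_add, simp add: algebra_simps)
qed simp

lemma eval_ac_smult [simp]: "eval_ac (smult c g) x = to_ac c * eval_ac g x"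
  by (induction g) (simp_all add: algebra_simps)

lemma eval_ac_mult [simp]: "eval_ac (g * h) x = eval_ac g x * eval_ac h x"
  by (induction g) (simp_all add: algebra_simps)

lemma eval_ac_pcompose [simp]: "eval_ac (pcompose g h) x = eval_ac g (eval_ac h x)"
  by (induction g) (simp_all add: pcompose_pCons)

lemma roots_ac_iff: "x \<in> roots_ac g \<longleftrightarrow> eval_ac g x = 0"
  by (simp add: roots_ac_def)

lemma degree_map_poly_to_ac [simp]: "degree (map_poly to_ac g) = degree g"
  by (rule degree_map_poly) simp

lemma roots_ac_nonempty:
  assumes "degree g > 0"
  shows "roots_ac g \<noteq> {}"
proof -
  have "\<exists>x. eval_ac g x = 0"
    by (rule alg_closed_imp_poly_has_root) (use assms in simp)
  then show ?thesis
    by (auto simp: roots_ac_iff)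
qed

text \<open>All notions defined by \<open>the_elem\<close> over a set of choices are evaluated
  through this lemma: it suffices to compute the value at an arbitrary choice.\<close>

lemma the_elem_image_const:
  assumes "A \<noteq> {}" and "\<And>x. x \<in> A \<Longrightarrow> h x = c"
  shows "the_elem (h ` A) = c"
proof -
  from assms have "h ` A = {c}"
    by auto
  then show ?thesis
    by simp
qed

section \<open>Minimal polynomials\<close>

text \<open>A nonzero polynomial \<open>r\<close> of least degree vanishing at \<open>x\<close>
  divides every polynomial vanishing at \<open>x\<close>, by division with remainder. It is not a
  unit, because the constant 1 has no root, so the irreducible \<open>g\<close> is associated to
  \<open>r\<close>.\<close>

lemma irreducible_dvd_if_common_root:
  fixes g q :: "'a::field poly"
  assumes g: "irreducible g" and "x \<in> roots_ac g" and "x \<in> roots_ac q"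
  shows "g dvd q"
proof -
  let ?P = "\<lambda>r. r \<noteq> 0 \<and> x \<in> roots_ac r"
  from assms have "?P g"
    by auto
  then obtain r where r: "?P r" and r_min: "\<And>s. ?P s \<Longrightarrow> degree r \<le> degree s"
    using ex_has_least_nat[of ?P g degree] by blast
  have r_dvd: "r dvd s" if "x \<in> roots_ac s" for s
  proof (rule ccontr)
    assume "\<not> r dvd s"
    then have nz: "s mod r \<noteq> 0"
      by (simp add: dvd_eq_mod_eq_0)
    have "eval_ac (s div r * r + s mod r) x = 0"
      using that by (simp only: div_mult_mod_eq roots_ac_iff)
    then have "eval_ac (s div r) x * eval_ac r x + eval_ac (s mod r) x = 0"
      by (simp only: eval_ac_add eval_ac_mult)
    then have "x \<in> roots_ac (s mod r)"
      using r by (simp add: roots_ac_iff)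
    with nz have "degree r \<le> degree (s mod r)"
      by (intro r_min) simp
    with degree_mod_less'[of r s] r nz show False
      by simp
  qed
  obtain s where s: "g = r * s"
    using r_dvd[OF assms(2)] by (elim dvdE)
  have "\<not> r dvd 1"
  proof
    assume "r dvd 1"
    then obtain t where t: "1 = r * t"
      by (elim dvdE)
    have "eval_ac (r * t) x = 0"
      using r by (simp add: roots_ac_iff)
    then show False
      unfolding t[symmetric] by simp
  qed
  with irreducibleD[OF g s] have "s dvd 1"
    by simp
  then have "g dvd r"
    unfolding s by (simp add: mult_unit_dvd_iff)
  with r_dvd[OF assms(3)] show ?thesis
    using dvd_trans by blast
qed

lemma min_poly_eqI:
  fixes g :: "'a::field poly"
  assumes "lead_coeff g = 1" and "irreducible g" and "x \<in> roots_ac g"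
  shows "min_poly x = g"
  unfolding min_poly_def
proof (rule the_equality)
  have le: "degree g \<le> degree q" if "q \<noteq> 0" "x \<in> roots_ac q" for q
    using irreducible_dvd_if_common_root[OF assms(2,3)] that dvd_imp_degree_le by blast
  then show "lead_coeff g = 1 \<and> x \<in> roots_ac g \<and>
      (\<forall>q. q \<noteq> 0 \<and> x \<in> roots_ac q \<longrightarrow> degree g \<le> degree q)"
    using assms by blast
  fix p
  assume p: "lead_coeff p = 1 \<and> x \<in> roots_ac p \<and>
      (\<forall>q. q \<noteq> 0 \<and> x \<in> roots_ac q \<longrightarrow> degree p \<le> degree q)"
  then have "p \<noteq> 0" and "g \<noteq> 0"
    using assms by auto
  with p le assms(3) have deg: "degree p = degree g"
    by (meson order_antisym)
  obtain s where s: "p = g * s"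
    using irreducible_dvd_if_common_root[OF assms(2,3)] p by (meson dvdE)
  with deg \<open>p \<noteq> 0\<close> have "degree s = 0"
    by (simp add: degree_mult_eq)
  moreover have "lead_coeff s = 1"
    using p assms(1) unfolding s by (simp add: lead_coeff_mult)
  ultimately have "s = 1"
    by (metis degree_0_id one_pCons)
  then show "p = g"
    using s by simp
qed

section \<open>Affine substitutions\<close>

lemma degree_subst_affine [simp]: "a \<noteq> 0 \<Longrightarrow> degree (subst_affine a b g) = degree g"
  by (simp add: subst_affine_def degree_pcompose)

lemma lead_coeff_subst_affine:
  "a \<noteq> 0 \<Longrightarrow> lead_coeff (subst_affine a b g) = lead_coeff g"
  using lead_coeff_comp[of "[:b, a:]" g]
  by (simp add: subst_affine_def degree_pcompose power_inverse)

text \<open>Both sides substitute \<open>c (a x + b) + d\<close> into \<open>g\<close>, and the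
  normalising factors multiply. Hence clusters are orbits of the affine group and blocks are orbits
  of the translations.\<close>

lemma subst_affine_subst_affine:
  assumes "a \<noteq> 0" and "c \<noteq> 0"
  shows "subst_affine a b (subst_affine c d g) = subst_affine (a * c) (c * b + d) g"
  using assms
  by (simp add: subst_affine_def degree_pcompose pcompose_smult pcompose_pCons power_mult_distrib
      flip: pcompose_assoc) (simp add: algebra_simps)

lemma subst_affine_id [simp]: "subst_affine 1 0 g = g"
  by (simp add: subst_affine_def)

lemma roots_ac_subst_affine:
  "a \<noteq> 0 \<Longrightarrow> x \<in> roots_ac (subst_affine a b g) \<longleftrightarrow> to_ac a * x + to_ac b \<in> roots_ac g"
  by (simp add: subst_affine_def roots_ac_iff add.commute mult.commute)

text \<open>Substituting a linear polynomial is a degree-preserving ring automorphism whose inverse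
  substitutes \<open>?m\<close>, so a factorisation of the image pulls back to one of
  \<open>g\<close>.\<close>

lemma irreducible_pcompose_linear:
  fixes g :: "'a::field poly"
  assumes "irreducible g" and "a \<noteq> 0"
  shows "irreducible (pcompose g [:b, a:])"
proof (rule irreducibleI)
  let ?m = "[:- b / a, 1 / a:]"
  have inv: "pcompose [:b, a:] ?m = [:0, 1:]"
    using assms(2) by (simp add: pcompose_pCons)
  have deg: "degree (pcompose h ?m) = degree h" for h :: "'a poly"
    using assms(2) by (simp add: degree_pcompose)
  have nz: "g \<noteq> 0"
    using assms by auto
  then show "pcompose g [:b, a:] \<noteq> 0"
    using assms(2) by (simp add: pcompose_eq_0_iff)
  show "\<not> pcompose g [:b, a:] dvd 1"
    using assms nz irreducible_not_unit[OF assms(1)]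
    by (simp add: is_unit_iff_degree pcompose_eq_0_iff degree_pcompose)
  fix s t
  assume st: "pcompose g [:b, a:] = s * t"
  then have "pcompose (pcompose g [:b, a:]) ?m = pcompose s ?m * pcompose t ?m"
    by (simp add: pcompose_mult)
  then have g: "g = pcompose s ?m * pcompose t ?m"
    by (simp only: pcompose_assoc[symmetric] inv pcompose_idR)
  have "s \<noteq> 0" "t \<noteq> 0"
    using st \<open>pcompose g [:b, a:] \<noteq> 0\<close> by auto
  moreover have "pcompose s ?m \<noteq> 0" "pcompose t ?m \<noteq> 0"
    using g nz by auto
  ultimately show "s dvd 1 \<or> t dvd 1"
    using irreducibleD[OF assms(1) g] by (metis is_unit_iff_degree deg)
qed

lemma irreducible_subst_affine:
  fixes g :: "'a::field poly"
  assumes "irreducible g" and "a \<noteq> 0"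
  shows "irreducible (subst_affine a b g)"
proof -
  let ?c = "inverse a ^ degree g"
  have "subst_affine a b g = [:?c:] * pcompose g [:b, a:]"
    by (simp add: subst_affine_def)
  moreover have "[:?c:] dvd 1"
    using assms(2) by (simp add: is_unit_iff_degree)
  ultimately show ?thesis
    using irreducible_pcompose_linear[OF assms, of b] irreducible_mult_unit_left by metis
qed

lemma min_poly_affine:
  fixes g :: "'a::field poly"
  assumes "lead_coeff g = 1" and "irreducible g" and "x \<in> roots_ac g" and "u \<noteq> 0"
  shows "min_poly (to_ac u * x + to_ac v) = subst_affine (1 / u) (- v / u) g"
proof (rule min_poly_eqI)
  show "lead_coeff (subst_affine (1 / u) (- v / u) g) = 1"
    using assms lead_coeff_subst_affine[of "1 / u" "- v / u" g] by simp
  show "irreducible (subst_affine (1 / u) (- v / u) g)"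
    using assms by (intro irreducible_subst_affine) auto
  have "to_ac (1 / u) * (to_ac u * x + to_ac v) + to_ac (- v / u) = x"
    using assms(4) by (simp add: distrib_left add_divide_distrib)
  with assms(3) show "to_ac u * x + to_ac v \<in> roots_ac (subst_affine (1 / u) (- v / u) g)"
    using assms(4) by (subst roots_ac_subst_affine) auto
qed

text \<open>The substitution keeps the leading coefficient and replaces each root \<open>x\<close>
  by \<open>(x - b) / a\<close>, so the squared difference of the roots is divided by
  \<open>a\<^sup>2\<close>. The proof computes with coefficients.\<close>

lemma quad_disc_subst_affine:
  assumes "degree g = 2" and "a \<noteq> 0"
  shows "quad_disc (subst_affine a b g) = quad_disc g / a\<^sup>2"
proof -
  have g: "g = [:coeff g 0, coeff g 1, coeff g 2:]"
    using assms(1) by (intro poly_eqI)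
      (auto simp: coeff_pCons numeral_2_eq_2 coeff_eq_0 split: nat.splits)
  obtain p q r where "g = [:q, p, r:]"
    using g by metis
  then show ?thesis
    using assms unfolding quad_disc_def subst_affine_def
    by (simp add: pcompose_pCons numeral_2_eq_2 field_simps)
qed

section \<open>Clusters and blocks as orbits\<close>

lemma subst_affine_in_cluster: "a \<noteq> 0 \<Longrightarrow> subst_affine a b g \<in> cluster g"
  unfolding cluster_def by blast

lemma cluster_subst_affine:
  assumes "a \<noteq> 0"
  shows "cluster (subst_affine a b g) = cluster g"
proof
  show "cluster (subst_affine a b g) \<subseteq> cluster g"
    using assms unfolding cluster_def
    by (auto simp: subst_affine_subst_affine) (metis mult_eq_0_iff)
  show "cluster g \<subseteq> cluster (subst_affine a b g)"
  proof
    fix h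
    assume "h \<in> cluster g"
    then obtain c d where h: "h = subst_affine c d g" "c \<noteq> 0"
      by (auto simp: cluster_def)
    \<comment> \<open>The parameters solve \<open>a * a' = c\<close> and
      \<open>a * b' + b = d\<close> for \<open>a'\<close> and \<open>b'\<close>.\<close>
    then have "h = subst_affine (c / a) ((d - b) / a) (subst_affine a b g)"
      using assms by (simp add: subst_affine_subst_affine)
    then show "h \<in> cluster (subst_affine a b g)"
      using h(2) assms subst_affine_in_cluster by (metis divide_eq_0_iff)
  qed
qed

lemma block_shift: "block (shift b g) = block g"
proof
  show "block (shift b g) \<subseteq> block g"
    by (auto simp: block_def shift_def subst_affine_subst_affine)
  show "block g \<subseteq> block (shift b g)"
  proof
    fix h
    assume "h \<in> block g"
    then obtain d where "h = shift d g"
      by (auto simp: block_def)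
    then have "h = shift (d - b) (shift b g)"
      by (simp add: shift_def subst_affine_subst_affine)
    then show "h \<in> block (shift b g)"
      by (auto simp: block_def)
  qed
qed

text \<open>Translations have scaling factor 1, so the discriminant can be read off any
  representative.\<close>

lemma block_disc_block:
  assumes "degree g = 2"
  shows "block_disc (block g) = quad_disc g"
  unfolding block_disc_def
  by (rule the_elem_image_const)
    (use assms in \<open>auto simp: block_def shift_def quad_disc_subst_affine\<close>)

lemma monic_quadratic_eq:
  fixes g :: "'a::field poly"
  assumes "lead_coeff g = 1" and "degree g = 2"
  obtains p q where "g = [:q, p, 1:]"
proof
  show "g = [:coeff g 0, coeff g 1, 1:]"
    using assms by (intro poly_eqI)
      (auto simp: coeff_pCons numeral_2_eq_2 coeff_eq_0 split: nat.splits)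
qed

lemma root_ac_monic_quadratic:
  assumes "x \<in> roots_ac [:q, p, 1:]"
  shows "x * x = - to_ac p * x - to_ac q"
proof -
  have "x * x - (- to_ac p * x - to_ac q) = eval_ac [:q, p, 1:] x"
    by (simp add: algebra_simps)
  also have "\<dots> = 0"
    using assms by (simp only: roots_ac_iff)
  finally show ?thesis
    by (simp only: right_minus_eq)
qed

section \<open>Simple extensions by a quadratic element\<close>

lemma ring_of_type_algebra_simps [simp]:
  "x \<otimes>\<^bsub>ring_of_type_algebra\<^esub> y = x * y"
  "x \<oplus>\<^bsub>ring_of_type_algebra\<^esub> y = x + y"
  "\<one>\<^bsub>ring_of_type_algebra\<^esub> = 1"
  "\<zero>\<^bsub>ring_of_type_algebra\<^esub> = 0"
  "carrier ring_of_type_algebra = UNIV"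
  by (simp_all add: ring_of_type_algebra_def)

lemma ring_of_type_algebra_a_inv [simp]:
  "\<ominus>\<^bsub>ring_of_type_algebra\<^esub> x = - (x :: 'b::field)"
proof -
  interpret R: field "ring_of_type_algebra :: 'b ring"
    by (rule field_from_type_algebra)
  show ?thesis
    using R.minus_equality[of "- x" x] by simp
qed

lemma ring_of_type_algebra_m_inv [simp]:
  assumes "x \<noteq> (0 :: 'b::field)"
  shows "inv\<^bsub>ring_of_type_algebra\<^esub> x = inverse x"
proof -
  interpret R: field "ring_of_type_algebra :: 'b ring"
    by (rule field_from_type_algebra)
  show ?thesis
    using assms R.comm_inv_char[of x "inverse x"] by simp
qed

lemma adjoin_generator: "x \<in> adjoin x"
  and adjoin_base: "to_ac c \<in> adjoin x"
  unfolding adjoin_def by (simp_all add: generate_field.incl)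

lemma adjoin_add: "y \<in> adjoin x \<Longrightarrow> z \<in> adjoin x \<Longrightarrow> y + z \<in> adjoin x"
  unfolding adjoin_def using generate_field.eng_add by fastforce

lemma adjoin_mult: "y \<in> adjoin x \<Longrightarrow> z \<in> adjoin x \<Longrightarrow> y * z \<in> adjoin x"
  unfolding adjoin_def using generate_field.eng_mult by fastforce

lemma adjoin_subset:
  assumes "y \<in> adjoin x"
  shows "adjoin y \<subseteq> adjoin x"
proof -
  interpret R: field "ring_of_type_algebra :: 'a alg_closure ring"
    by (rule field_from_type_algebra)
  have "insert y (range to_ac) \<subseteq> adjoin x"
    using assms adjoin_base by auto
  then show ?thesis
    unfolding adjoin_def
    by (intro R.generate_field_min_subfield1 R.generate_field_is_subfield) auto
qed

lemma adjoin_affine: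
  assumes "u \<noteq> 0"
  shows "adjoin (to_ac u * x + to_ac v) = adjoin x"
proof
  let ?y = "to_ac u * x + to_ac v"
  show "adjoin ?y \<subseteq> adjoin x"
    by (intro adjoin_subset adjoin_add adjoin_mult adjoin_base adjoin_generator)
  have "to_ac (1 / u) * ?y + to_ac (- v / u) \<in> adjoin ?y"
    by (intro adjoin_add adjoin_mult adjoin_base adjoin_generator)
  also have "to_ac (1 / u) * ?y + to_ac (- v / u) = x"
    using assms by (simp add: distrib_left add_divide_distrib)
  finally show "adjoin x \<subseteq> adjoin ?y"
    by (rule adjoin_subset)
qed

lemma adjoin_to_ac: "adjoin (to_ac c) = range to_ac"
proof
  show "range to_ac \<subseteq> adjoin (to_ac c)"
    using adjoin_base by auto
  show "adjoin (to_ac c) \<subseteq> range to_ac"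
  proof
    fix z
    assume "z \<in> adjoin (to_ac c)"
    then show "z \<in> range to_ac"
      unfolding adjoin_def
      by (induction rule: generate_field.induct)
        (auto simp flip: to_ac_1 to_ac_add to_ac_mult to_ac_minus to_ac_inverse)
  qed
qed

text \<open>A root \<open>c\<close> in K would force the quadratic \<open>g\<close> to divide
  \<open>X - c\<close>.\<close>

lemma irreducible_quadratic_root_notin_base:
  assumes "irreducible g" and "degree g = 2" and "x \<in> roots_ac g"
  shows "x \<notin> range to_ac"
proof
  assume "x \<in> range to_ac"
  then obtain c where "x = to_ac c"
    by auto
  then have "x \<in> roots_ac [:- c, 1:]"
    by (simp add: roots_ac_iff)
  with assms have "g dvd [:- c, 1:]"
    by (intro irreducible_dvd_if_common_root)
  then have "degree g \<le> degree [:- c, 1:]"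
    by (rule dvd_imp_degree_le) simp
  with assms(2) show False
    by simp
qed

text \<open>The K-span of \<open>x\<close> and 1 is closed under the field operations:
  \<open>x * x\<close> reduces by the equation of \<open>x\<close>, and inverses come from dividing
  the conjugate by the norm.\<close>

lemma adjoin_quadratic:
  assumes "irreducible [:q, p, 1:]" and "x \<in> roots_ac [:q, p, 1:]"
  shows "adjoin x = {to_ac u * x + to_ac v | u v. True}" (is "_ = ?S")
proof
  show "?S \<subseteq> adjoin x"
    by (auto intro!: adjoin_add adjoin_mult adjoin_base adjoin_generator)
  have sq: "x * x = - to_ac p * x - to_ac q"
    using root_ac_monic_quadratic[OF assms(2)] .
  have notin: "x \<notin> range to_ac"
    using assms by (intro irreducible_quadratic_root_notin_base) auto
  have S: "to_ac u * x + to_ac v \<in> ?S" for u v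
    by blast
  show "adjoin x \<subseteq> ?S"
  proof
    fix z
    assume "z \<in> adjoin x"
    then show "z \<in> ?S"
      unfolding adjoin_def
    proof (induction rule: generate_field.induct)
      case one
      show ?case
        using S[of 0 1] by simp
    next
      case (incl h)
      then show ?case
        using S[of 1 0] S[of 0] by auto
    next
      case (a_inv h)
      then obtain u v where "h = to_ac u * x + to_ac v"
        by blast
      then show ?case
        using S[of "- u" "- v"] by simp
    next
      case (m_inv h)
      then obtain u v where h: "h = to_ac u * x + to_ac v"
        by blast
      have h0: "h \<noteq> 0"
        using m_inv by simp
      \<comment> \<open>The norm of \<open>h\<close>, the product of \<open>h\<close> and its conjugate.\<close>
      define n where "n = v * v - u * v * p + u * u * q"
      \<comment> \<open>The other root of the quadratic is \<open>- x - to_ac p\<close>; putting it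
        in place of \<open>x\<close> in \<open>h\<close> gives this conjugate.\<close>
      define h' where "h' = to_ac (- u) * x + to_ac (v - u * p)"
      have hh': "h * h' = to_ac n"
      proof -
        have "h * h' = - to_ac u * to_ac u * (x * x) - to_ac u * to_ac u * to_ac p * x
            + to_ac v * (to_ac v - to_ac u * to_ac p)"
          by (simp add: h h'_def algebra_simps)
        then show ?thesis
          unfolding sq by (simp add: n_def algebra_simps)
      qed
      \<comment> \<open>If \<open>u = 0\<close>, then \<open>h' = h\<close>; otherwise
        \<open>h' = 0\<close> would place \<open>x\<close> in K.\<close>
      have "h' \<noteq> 0"
      proof
        assume h'0: "h' = 0"
        show False
        proof (cases "u = 0")
          case True
          then show False
            using h'0 h h0 by (simp add: h'_def)
        next
          case False
          then have "x = to_ac ((v - u * p) / u)"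
            using h'0 by (simp add: h'_def field_simps)
          with notin show False
            by blast
        qed
      qed
      with hh' h0 have "n \<noteq> 0"
        by auto
      have "inverse h = h' * inverse (to_ac n)"
        using hh' h0 \<open>h' \<noteq> 0\<close> by (simp add: field_simps flip: hh')
      then have "inverse h = to_ac (- u / n) * x + to_ac ((v - u * p) / n)"
        by (simp add: h'_def divide_inverse algebra_simps)
      then have "inverse h \<in> ?S"
        using S by (simp only:)
      then show ?case
        using h0 by simp
    next
      case (eng_add h1 h2)
      then obtain u v u' v' where "h1 = to_ac u * x + to_ac v" "h2 = to_ac u' * x + to_ac v'"
        by blast
      then show ?case
        using S[of "u + u'" "v + v'"] by (simp add: algebra_simps)
    next
      case (eng_mult h1 h2)
      then obtain u v u' v' where h: "h1 = to_ac u * x + to_ac v" "h2 = to_ac u' * x + to_ac v'"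
        by blast
      have "h1 * h2 = to_ac u * to_ac u' * (x * x) + to_ac (u * v' + v * u') * x + to_ac (v * v')"
        by (simp add: h algebra_simps)
      also have "\<dots> = to_ac (u * v' + v * u' - u * u' * p) * x + to_ac (v * v' - u * u' * q)"
        unfolding sq by (simp add: algebra_simps)
      finally have "h1 * h2 \<in> ?S"
        using S by (simp only:)
      then show ?case
        by simp
    qed
  qed
qed

section \<open>The vertices and blocks of the extension graph\<close>

locale monic_irreducible_quadratic =
  fixes f :: "'a::field poly"
  assumes monic: "lead_coeff f = 1"
    and irred: "irreducible f"
    and deg: "degree f = 2"
begin

lemma ext_vertices_eq_cluster: "ext_vertices f = cluster f"
  unfolding ext_vertices_def
proof (rule the_elem_image_const)
  show "roots_ac f \<noteq> {}"
    by (rule roots_ac_nonempty) (simp add: deg)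
  fix x
  assume x: "x \<in> roots_ac f"
  obtain p q where f: "f = [:q, p, 1:]"
    using monic_quadratic_eq[OF monic deg] .
  have adj: "adjoin x = {to_ac u * x + to_ac v | u v. True}"
    using adjoin_quadratic irred x unfolding f .
  have notin: "x \<notin> range to_ac"
    using irreducible_quadratic_root_notin_base irred deg x .
  have "{y \<in> adjoin x. adjoin y = adjoin x} = {to_ac u * x + to_ac v | u v. u \<noteq> 0}"
  proof (intro equalityI subsetI)
    fix y
    assume "y \<in> {y \<in> adjoin x. adjoin y = adjoin x}"
    then obtain u v where y: "y = to_ac u * x + to_ac v" "adjoin y = adjoin x"
      using adj by blast
    \<comment> \<open>For \<open>u = 0\<close> the element lies in K and generates only K, which
      does not contain \<open>x\<close>.\<close>
    have "u \<noteq> 0"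
    proof
      assume "u = 0"
      with y have "adjoin x = range to_ac"
        using adjoin_to_ac[of v] by simp
      with notin show False
        using adjoin_generator by blast
    qed
    with y show "y \<in> {to_ac u * x + to_ac v | u v. u \<noteq> 0}"
      by blast
  next
    fix y
    assume "y \<in> {to_ac u * x + to_ac v | u v. u \<noteq> 0}"
    then obtain u v where "u \<noteq> 0" and y: "y = to_ac u * x + to_ac v"
      by blast
    then have "adjoin y = adjoin x"
      by (simp add: adjoin_affine)
    moreover from this have "y \<in> adjoin x"
      using adjoin_generator[of y] by simp
    ultimately show "y \<in> {y \<in> adjoin x. adjoin y = adjoin x}"
      by simp
  qed
  then have "min_poly ` {y \<in> adjoin x. adjoin y = adjoin x} =
      min_poly ` {to_ac u * x + to_ac v | u v. u \<noteq> 0}"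
    by simp
  also have "\<dots> = {min_poly (to_ac u * x + to_ac v) | u v. u \<noteq> 0}"
    by blast
  also have "\<dots> = {subst_affine (1 / u) (- v / u) f | u v. u \<noteq> 0}"
    using min_poly_affine[OF monic irred x] by metis
  also have "\<dots> = cluster f"
  proof
    show "{subst_affine (1 / u) (- v / u) f | u v. u \<noteq> 0} \<subseteq> cluster f"
      unfolding cluster_def by fastforce
    \<comment> \<open>Solving \<open>a = 1 / u\<close> and \<open>b = - v / u\<close> gives
      \<open>u = 1 / a\<close> and \<open>v = - b / a\<close>.\<close>
    have "subst_affine a b f = subst_affine (1 / (1 / a)) (- (- b / a) / (1 / a)) f"
      if "a \<noteq> 0" for a b
      using that by simp
    moreover have "1 / a \<noteq> 0" if "a \<noteq> 0" for a :: 'a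
      using that by simp
    ultimately show "cluster f \<subseteq> {subst_affine (1 / u) (- v / u) f | u v. u \<noteq> 0}"
      unfolding cluster_def by blast
  qed
  finally show "min_poly ` {y \<in> adjoin x. adjoin y = adjoin x} = cluster f" .
qed

text \<open>The hypothesis combines \<open>b \<noteq> 0\<close> with characteristic other than 2.
  The offset \<open>c\<close> stays unspecified because only the scaling factor affects the
  discriminant.\<close>

lemma wedge_shift:
  assumes "2 * b \<noteq> 0"
  obtains c where "f \<sqinter>\<^sub>p shift b f = subst_affine (- 1 / (2 * b)) c f"
proof -
  obtain p q where f: "f = [:q, p, 1:]"
    using monic_quadratic_eq[OF monic deg] .
  have nz: "- 2 * b \<noteq> 0"
    using assms by simp
  have "f \<sqinter>\<^sub>p shift b f = subst_affine (1 / (- 2 * b)) (- (b * b - p * b) / (- 2 * b)) f"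
    unfolding wedge_def
  proof (rule the_elem_image_const)
    show "roots_ac (shift b f) \<noteq> {}"
      by (rule roots_ac_nonempty) (simp add: deg shift_def)
    fix y
    assume "y \<in> roots_ac (shift b f)"
    then have x: "y + to_ac b \<in> roots_ac f"
      by (simp add: shift_def roots_ac_subst_affine)
    \<comment> \<open>With \<open>x = y + to_ac b\<close>, a root of \<open>f\<close>, this expands
      \<open>f(x - b)\<close> as \<open>f(x)\<close> plus an affine expression in
      \<open>x\<close>.\<close>
    have "eval_ac f y = to_ac (- 2 * b) * (y + to_ac b) + to_ac (b * b - p * b)
        + eval_ac f (y + to_ac b)"
      unfolding f by (simp add: algebra_simps)
    also have "\<dots> = to_ac (- 2 * b) * (y + to_ac b) + to_ac (b * b - p * b)"
      using x by (simp only: roots_ac_iff add_0_right)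
    finally have "eval_ac f y = to_ac (- 2 * b) * (y + to_ac b) + to_ac (b * b - p * b)" .
    then show "min_poly (eval_ac f y) =
        subst_affine (1 / (- 2 * b)) (- (b * b - p * b) / (- 2 * b)) f"
      using min_poly_affine[OF monic irred x nz] by (simp only:)
  qed
  with that show thesis
    by simp
qed

end

section \<open>Discriminants classify the blocks\<close>

text \<open>Separability enters as a nonzero discriminant, a condition that affine substitutions
  visibly preserve; the locale can thus be interpreted at every vertex of
  \<open>E(f)\<close>.\<close>

locale separable_quadratic = monic_irreducible_quadratic +
  assumes disc_nz: "quad_disc f \<noteq> 0"
begin

lemma separable_quadratic_subst_affine:
  assumes "a \<noteq> 0"
  shows "separable_quadratic (subst_affine a b f)"
proof
  show "lead_coeff (subst_affine a b f) = 1"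
    using assms lead_coeff_subst_affine[of a b f] monic by simp
  show "irreducible (subst_affine a b f)"
    using assms irred by (rule irreducible_subst_affine[rotated])
  show "degree (subst_affine a b f) = 2"
    using assms deg by simp
  show "quad_disc (subst_affine a b f) \<noteq> 0"
    using assms deg disc_nz by (simp add: quad_disc_subst_affine)
qed

text \<open>The substitution \<open>x \<mapsto> - x - p\<close> exchanges the two roots of \<open>f = x\<^sup>2 + p x + q\<close> and so
  fixes \<open>f\<close>; hence \<open>\<sigma>\<^bsub>-1,b\<^esub>(f)\<close> is a translate of \<open>f\<close>.\<close>

lemma block_subst_affine_eq_iff:
  assumes "a \<noteq> 0"
  shows "block (subst_affine a b f) = block f \<longleftrightarrow> a\<^sup>2 = 1"
proof
  assume "block (subst_affine a b f) = block f"
  then have "quad_disc (subst_affine a b f) = quad_disc f"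
    using assms deg block_disc_block by (metis degree_subst_affine)
  then show "a\<^sup>2 = 1"
    using assms deg disc_nz by (auto simp: quad_disc_subst_affine divide_eq_eq)
next
  assume "a\<^sup>2 = 1"
  then consider "a = 1" | "a = - 1"
    by (auto simp: power2_eq_1_iff)
  then show "block (subst_affine a b f) = block f"
  proof cases
    case 1
    then show ?thesis
      using block_shift by (simp add: shift_def)
  next
    case 2
    obtain p q where f: "f = [:q, p, 1:]"
      using monic_quadratic_eq[OF monic deg] .
    \<comment> \<open>Replacing the argument \<open>b - x\<close> by
      \<open>- (b - x) - p = x + (- p - b)\<close> leaves the value of \<open>f\<close>
      unchanged.\<close>
    have "subst_affine a b f = shift (- p - b) f"
      unfolding 2 f shift_def subst_affine_def
      by (simp add: pcompose_pCons algebra_simps)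
    then show ?thesis
      using block_shift by simp
  qed
qed

lemma cluster_mem:
  assumes "g \<in> cluster f"
  shows "separable_quadratic g" and "cluster g = cluster f"
proof -
  obtain a b where "g = subst_affine a b f" "a \<noteq> 0"
    using assms by (auto simp: cluster_def)
  then show "separable_quadratic g" and "cluster g = cluster f"
    by (simp_all add: separable_quadratic_subst_affine cluster_subst_affine)
qed

text \<open>Representatives of two blocks differ by an affine substitution with some factor
  \<open>a\<close>. Equal nonzero discriminants force \<open>a\<^sup>2 = 1\<close>, and then the
  blocks agree.\<close>

lemma inj_on_block_disc: "inj_on block_disc (blocks f)"
proof (rule inj_onI)
  fix \<Theta> \<Theta>'
  assume "\<Theta> \<in> blocks f" "\<Theta>' \<in> blocks f" and disc: "block_disc \<Theta> = block_disc \<Theta>'"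
  then obtain g h where g: "g \<in> cluster f" "\<Theta> = block g" and h: "h \<in> cluster f" "\<Theta>' = block h"
    by (auto simp: blocks_def ext_vertices_eq_cluster)
  interpret g: separable_quadratic g
    using cluster_mem(1)[OF g(1)] .
  interpret h: separable_quadratic h
    using cluster_mem(1)[OF h(1)] .
  have "h \<in> cluster g"
    using g(1) h(1) by (simp add: cluster_mem(2))
  then obtain a b where ab: "h = subst_affine a b g" "a \<noteq> 0"
    by (auto simp: cluster_def)
  have "quad_disc h = quad_disc g"
    using disc g(2) h(2) by (simp add: block_disc_block g.deg h.deg)
  then have "a\<^sup>2 = 1"
    using ab g.deg g.disc_nz by (auto simp: quad_disc_subst_affine divide_eq_eq)
  then show "\<Theta> = \<Theta>'"
    using g.block_subst_affine_eq_iff[OF ab(2)] ab(1) g(2) h(2) by simp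
qed

lemma block_disc_nz:
  assumes "\<Theta> \<in> blocks f"
  shows "block_disc \<Theta> \<noteq> 0"
proof -
  obtain g where g: "g \<in> cluster f" "\<Theta> = block g"
    using assms by (auto simp: blocks_def ext_vertices_eq_cluster)
  interpret g: separable_quadratic g
    using cluster_mem(1)[OF g(1)] .
  show ?thesis
    using g g.disc_nz g.deg by (simp add: block_disc_block)
qed

text \<open>The representatives are related by a factor \<open>a\<close>, and
  \<open>k = 1 / a\<close>. This is the source of the arcs of the block graph.\<close>

lemma block_disc_ratio_square:
  assumes "\<Theta> \<in> blocks f" and "\<Theta>' \<in> blocks f"
  obtains k where "k \<noteq> 0" and "block_disc \<Theta>' = k\<^sup>2 * block_disc \<Theta>"
proof -
  obtain g h where g: "g \<in> cluster f" "\<Theta> = block g" and h: "h \<in> cluster f" "\<Theta>' = block h"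
    using assms by (auto simp: blocks_def ext_vertices_eq_cluster)
  interpret g: separable_quadratic g
    using cluster_mem(1)[OF g(1)] .
  have "h \<in> cluster g"
    using g(1) h(1) by (simp add: cluster_mem(2))
  then obtain a b where ab: "h = subst_affine a b g" "a \<noteq> 0"
    by (auto simp: cluster_def)
  then have "block_disc \<Theta>' = (1 / a)\<^sup>2 * block_disc \<Theta>"
    using g(2) h(2) g.deg by (simp add: block_disc_block quad_disc_subst_affine power_divide)
  with ab(2) show thesis
    by (intro that[of "1 / a"]) auto
qed

lemma block_map:
  assumes "2 * b \<noteq> 0" and "\<Theta> \<in> blocks f"
  shows "block_map f b \<Theta> \<in> blocks f"
    and "block_disc (block_map f b \<Theta>) = (2 * b)\<^sup>2 * block_disc \<Theta>"
proof -
  obtain g where g: "g \<in> cluster f" "\<Theta> = block g"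
    using assms by (auto simp: blocks_def ext_vertices_eq_cluster)
  interpret g: separable_quadratic g
    using cluster_mem(1)[OF g(1)] .
  let ?h = "\<lambda>h. h \<sqinter>\<^sub>p shift b h"
  \<comment> \<open>The discriminant is expressed through the fixed representative \<open>g\<close>,
    so that the values at different \<open>h\<close> can be compared.\<close>
  have *: "block (?h h) \<in> blocks f \<and>
      block_disc (block (?h h)) = (2 * b)\<^sup>2 * quad_disc g"
    if "h \<in> \<Theta>" for h
  proof -
    obtain c where c: "h = subst_affine 1 c g"
      using \<open>h \<in> \<Theta>\<close> g(2) by (auto simp: block_def shift_def)
    interpret h: separable_quadratic h
      unfolding c by (rule g.separable_quadratic_subst_affine) simp
    obtain d where d: "?h h = subst_affine (- 1 / (2 * b)) d h"
      using h.wedge_shift[OF assms(1)] .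
    have "?h h \<in> cluster h"
      unfolding d by (rule subst_affine_in_cluster) (use assms(1) in simp)
    also have "cluster h = cluster f"
      using cluster_mem(2)[OF g(1)] cluster_subst_affine[of 1 c g] by (simp add: c)
    finally have mem: "?h h \<in> cluster f" .
    have "block_disc (block (?h h)) = quad_disc h / (- 1 / (2 * b))\<^sup>2"
      using assms(1) h.deg unfolding d
      by (subst block_disc_block) (simp_all add: quad_disc_subst_affine)
    also have "\<dots> = (2 * b)\<^sup>2 * quad_disc g"
      using g.deg by (simp add: c quad_disc_subst_affine power_divide)
    finally have "block_disc (block (?h h)) = (2 * b)\<^sup>2 * quad_disc g" .
    with mem show ?thesis
      by (simp add: blocks_def ext_vertices_eq_cluster)
  qed
  have "g \<in> \<Theta>"
    unfolding g(2) block_def shift_def by (rule CollectI, rule exI[of _ 0]) simp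
  \<comment> \<open>Independence of the representative: both blocks have the same discriminant,
    which identifies a block.\<close>
  have eq: "block (?h h) = block (?h g)" if "h \<in> \<Theta>" for h
    using *[OF that] *[OF \<open>g \<in> \<Theta>\<close>] by (intro inj_onD[OF inj_on_block_disc]) auto
  have "the_elem ((\<lambda>h. block (?h h)) ` \<Theta>) = block (?h g)"
    using \<open>g \<in> \<Theta>\<close> by (intro the_elem_image_const eq) auto
  then have "block_map f b \<Theta> = block (?h g)"
    unfolding block_map_def using assms(2) by simp
  with *[OF \<open>g \<in> \<Theta>\<close>] show "block_map f b \<Theta> \<in> blocks f"
    "block_disc (block_map f b \<Theta>) = (2 * b)\<^sup>2 * block_disc \<Theta>"
    using g g.deg by (simp_all add: block_disc_block)
qed

end

text \<open>If the discriminant vanishes, any root \<open>x\<close> satisfies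
  \<open>(2 * x + to_ac p)\<^sup>2 = 0\<close>, so \<open>f\<close> becomes the square of
  \<open>X - x\<close>. There is no division by 2, so the argument covers every
  characteristic.\<close>

lemma separable_imp_quad_disc_nz:
  fixes f :: "'a::field poly"
  assumes "lead_coeff f = 1" and "degree f = 2" and "separable f"
  shows "quad_disc f \<noteq> 0"
proof
  assume disc: "quad_disc f = 0"
  obtain p q where f: "f = [:q, p, 1:]"
    using monic_quadratic_eq[OF assms(1,2)] .
  obtain x where x: "x \<in> roots_ac f"
    using roots_ac_nonempty[of f] assms(2) by auto
  then have q: "to_ac q = - x * x - to_ac p * x"
    using root_ac_monic_quadratic[of x q p] by (simp add: f)
  have "(2 * x + to_ac p)\<^sup>2 = (to_ac p)\<^sup>2 - 4 * to_ac q"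
    unfolding q by (simp add: power2_eq_square algebra_simps)
  also have "\<dots> = to_ac (quad_disc f)"
    by (simp add: quad_disc_def f numeral_2_eq_2)
  finally have "2 * x + to_ac p = 0"
    using disc by simp
  then have p: "to_ac p = - 2 * x"
    by (simp add: add_eq_0_iff2)
  have "map_poly to_ac f = [:- x, 1:] ^ 2"
    using q by (simp add: f map_poly_pCons p power2_eq_square)
  then have "order x (map_poly to_ac f) = 2"
    by (simp add: order_power_n_n)
  with assms(3) show False
    unfolding separable_def rsquarefree_def by (metis numeral_eq_one_iff semiring_norm(85) zero_neq_numeral)
qed

section \<open>Permutations scaling an invariant by squares\<close>

text \<open>An abstract form of the blocks: \<open>d\<close> is the discriminant and
  \<open>F b\<close> the map \<open>block_map f (b / 2)\<close>, the halving turning the factor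
  \<open>(2 * b)\<^sup>2\<close> into \<open>b\<^sup>2\<close>.\<close>

locale square_scaling =
  fixes S :: "'b set" and d :: "'b \<Rightarrow> 'a::field" and F :: "'a \<Rightarrow> 'b \<Rightarrow> 'b"
  assumes S_nonempty: "S \<noteq> {}"
    and inj_d: "inj_on d S"
    and d_nz: "x \<in> S \<Longrightarrow> d x \<noteq> 0"
    and F_extensional: "F b \<in> extensional S"
    and F_closed: "b \<noteq> 0 \<Longrightarrow> x \<in> S \<Longrightarrow> F b x \<in> S"
    and d_F: "b \<noteq> 0 \<Longrightarrow> x \<in> S \<Longrightarrow> d (F b x) = b\<^sup>2 * d x"
begin

text \<open>Since \<open>d\<close> separates points, a value of \<open>F b\<close> is determined by
  its invariant. Composition, identity and inverses of the maps all follow from this.\<close>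

lemma F_eqI:
  assumes "b \<noteq> 0" "x \<in> S" "y \<in> S" "d y = b\<^sup>2 * d x"
  shows "F b x = y"
  using assms F_closed d_F by (intro inj_onD[OF inj_d]) auto

lemma F_F: "b \<noteq> 0 \<Longrightarrow> c \<noteq> 0 \<Longrightarrow> x \<in> S \<Longrightarrow> F b (F c x) = F (b * c) x"
  by (rule F_eqI) (simp_all add: F_closed d_F power_mult_distrib)

lemma F_1: "x \<in> S \<Longrightarrow> F 1 x = x"
  by (rule F_eqI) simp_all

lemma F_Bij:
  assumes "b \<noteq> 0"
  shows "F b \<in> Bij S"
proof -
  have "bij_betw (F b) S S"
    by (rule bij_betw_byWitness[where f' = "F (1 / b)"])
      (use assms in \<open>auto simp: F_F F_1 F_closed\<close>)
  then show ?thesis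
    by (simp add: Bij_def F_extensional)
qed

lemma F_mult:
  assumes "b \<noteq> 0" "c \<noteq> 0"
  shows "F b \<otimes>\<^bsub>BijGroup S\<^esub> F c = F (b * c)"
proof -
  have "compose S (F b) (F c) = F (b * c)"
    by (rule extensionalityI[of _ S]) (use assms in \<open>auto simp: F_extensional compose_def F_F\<close>)
  then show ?thesis
    using assms by (simp add: BijGroup_def F_Bij)
qed

lemma F_one: "\<one>\<^bsub>BijGroup S\<^esub> = F 1"
  unfolding BijGroup_def
  by (simp, rule extensionalityI[of _ S]) (auto simp: F_extensional F_1)

text \<open>At any point the nonzero invariant can be cancelled, which recovers
  \<open>b\<^sup>2\<close> from \<open>F b\<close>. This makes the isomorphism below both well
  defined and injective.\<close>

lemma F_eq_iff:
  assumes "b \<noteq> 0" "c \<noteq> 0"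
  shows "F b = F c \<longleftrightarrow> b\<^sup>2 = c\<^sup>2"
proof
  assume "F b = F c"
  moreover obtain x where "x \<in> S"
    using S_nonempty by blast
  ultimately show "b\<^sup>2 = c\<^sup>2"
    using assms d_F[of b x] d_F[of c x] d_nz by simp
next
  assume "b\<^sup>2 = c\<^sup>2"
  then show "F b = F c"
    by (intro extensionalityI[of _ S] F_extensional F_eqI)
      (simp_all add: assms F_closed d_F)
qed

lemma subgroup_F: "subgroup {F b | b. b \<noteq> 0} (BijGroup S)"
proof -
  interpret B: group "BijGroup S"
    by (rule group_BijGroup)
  show ?thesis
  proof (rule B.subgroupI)
    show carrier: "{F b | b. b \<noteq> 0} \<subseteq> carrier (BijGroup S)"
      using F_Bij by (auto simp: BijGroup_def)
    show "{F b | b. b \<noteq> 0} \<noteq> {}"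
      using one_neq_zero by blast
    fix g
    assume "g \<in> {F b | b. b \<noteq> 0}"
    then obtain b where b: "g = F b" "b \<noteq> 0"
      by blast
    have "inv\<^bsub>BijGroup S\<^esub> g = F (1 / b)"
    proof (rule B.inv_equality)
      show "F (1 / b) \<otimes>\<^bsub>BijGroup S\<^esub> g = \<one>\<^bsub>BijGroup S\<^esub>"
        using b by (simp add: F_mult F_one)
      show "g \<in> carrier (BijGroup S)" "F (1 / b) \<in> carrier (BijGroup S)"
        using b carrier by fastforce+
    qed
    moreover have "1 / b \<noteq> 0"
      using b by simp
    ultimately show "inv\<^bsub>BijGroup S\<^esub> g \<in> {F b | b. b \<noteq> 0}"
      by blast
    fix h
    assume "h \<in> {F b | b. b \<noteq> 0}"
    then obtain c where c: "h = F c" "c \<noteq> 0"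
      by blast
    then have "g \<otimes>\<^bsub>BijGroup S\<^esub> h = F (b * c)" "b * c \<noteq> 0"
      using b by (simp_all add: F_mult)
    then show "g \<otimes>\<^bsub>BijGroup S\<^esub> h \<in> {F b | b. b \<noteq> 0}"
      by blast
  qed
qed

lemma square_group_iso:
  "\<exists>\<phi> \<in> iso square_group (BijGroup S \<lparr>carrier := {F b | b. b \<noteq> 0}\<rparr>).
     \<forall>b. b \<noteq> 0 \<longrightarrow> \<phi> (b\<^sup>2) = F b"
proof
  \<comment> \<open>Any nonzero square root of \<open>s\<close> may be chosen, since
    \<open>F\<close> depends only on the square.\<close>
  define \<phi> where "\<phi> s = F (SOME b. b \<noteq> 0 \<and> b\<^sup>2 = s)" for s
  have \<phi>: "\<phi> (b\<^sup>2) = F b" if "b \<noteq> 0" for b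
  proof -
    have "(SOME c. c \<noteq> 0 \<and> c\<^sup>2 = b\<^sup>2) \<noteq> 0 \<and> (SOME c. c \<noteq> 0 \<and> c\<^sup>2 = b\<^sup>2)\<^sup>2 = b\<^sup>2"
      by (rule someI_ex) (use that in blast)
    then show ?thesis
      unfolding \<phi>_def using that F_eq_iff by blast
  qed
  then show "\<forall>b. b \<noteq> 0 \<longrightarrow> \<phi> (b\<^sup>2) = F b"
    by blast
  show "\<phi> \<in> iso square_group (BijGroup S \<lparr>carrier := {F b | b. b \<noteq> 0}\<rparr>)"
  proof (rule isoI)
    show "\<phi> \<in> hom square_group (BijGroup S \<lparr>carrier := {F b | b. b \<noteq> 0}\<rparr>)"
    proof (rule homI)
      fix s t
      assume "s \<in> carrier (square_group :: 'a monoid)" "t \<in> carrier (square_group :: 'a monoid)"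
      then obtain b c where bc: "s = b\<^sup>2" "b \<noteq> 0" "t = c\<^sup>2" "c \<noteq> 0"
        by (auto simp: square_group_def)
      then show "\<phi> s \<in> carrier (BijGroup S \<lparr>carrier := {F b | b. b \<noteq> 0}\<rparr>)"
        using \<phi> by auto
      have "\<phi> (s * t) = F (b * c)"
        using bc \<phi>[of "b * c"] by (simp add: power_mult_distrib)
      then show "\<phi> (s \<otimes>\<^bsub>square_group\<^esub> t) =
          \<phi> s \<otimes>\<^bsub>BijGroup S \<lparr>carrier := {F b | b. b \<noteq> 0}\<rparr>\<^esub> \<phi> t"
        using bc \<phi> by (simp add: square_group_def F_mult)
    qed
    have "\<phi> ` {b\<^sup>2 | b. b \<noteq> 0} = {F b | b. b \<noteq> 0}"
      using \<phi> by (auto simp: image_iff) metis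
    moreover have "inj_on \<phi> {b\<^sup>2 | b. b \<noteq> 0}"
      using \<phi> F_eq_iff by (auto intro!: inj_onI)
    ultimately show "bij_betw \<phi> (carrier square_group)
        (carrier (BijGroup S \<lparr>carrier := {F b | b. b \<noteq> 0}\<rparr>))"
      by (simp add: bij_betw_def square_group_def)
  qed
qed

end

section \<open>The structure of quadratic extension graphs\<close>

theorem theorem4p1:
  fixes f :: "'a::field poly"
  assumes "lead_coeff f = 1" and "irreducible f" and "separable f" and "degree f = 2"
  shows "cluster ` ext_vertices f = {ext_vertices f} \<and>
         inj_on block_disc (blocks f) \<and>
         (CHAR('a) \<noteq> 2 \<longrightarrow>
           (\<forall>\<Theta>\<in>pverts (block_graph f). \<forall>\<Theta>'\<in>pverts (block_graph f).
              \<Theta> \<noteq> \<Theta>' \<longrightarrow> (\<Theta>, \<Theta>') \<in> parcs (block_graph f)) \<and>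
           subgroup {block_map f b | b. b \<noteq> 0} (BijGroup (blocks f)) \<and>
           (\<exists>\<phi> \<in> iso square_group (BijGroup (blocks f) \<lparr>carrier := {block_map f b | b. b \<noteq> 0}\<rparr>).
              \<forall>b. b \<noteq> 0 \<longrightarrow> \<phi> (b\<^sup>2) = block_map f (b / 2)))"
proof -
  interpret separable_quadratic f
    using assms separable_imp_quad_disc_nz[OF assms(1,4,3)] by unfold_locales
  have f_mem: "f \<in> cluster f"
    using subst_affine_in_cluster[of 1 0 f] by simp
  have "cluster ` cluster f = (\<lambda>_. cluster f) ` cluster f"
    by (rule image_cong) (simp_all add: cluster_mem(2))
  then have "cluster ` cluster f = {cluster f}"
    using f_mem by (simp only: image_constant)
  moreover have "(\<forall>\<Theta>\<in>pverts (block_graph f). \<forall>\<Theta>'\<in>pverts (block_graph f).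
              \<Theta> \<noteq> \<Theta>' \<longrightarrow> (\<Theta>, \<Theta>') \<in> parcs (block_graph f)) \<and>
           subgroup {block_map f b | b. b \<noteq> 0} (BijGroup (blocks f)) \<and>
           (\<exists>\<phi> \<in> iso square_group (BijGroup (blocks f) \<lparr>carrier := {block_map f b | b. b \<noteq> 0}\<rparr>).
              \<forall>b. b \<noteq> 0 \<longrightarrow> \<phi> (b\<^sup>2) = block_map f (b / 2))" if "CHAR('a) \<noteq> 2"
  proof -
    \<comment> \<open>Otherwise the characteristic divides 2 and is 1 or 2, but a field cannot have
      characteristic 1.\<close>
    have two: "(2::'a) \<noteq> 0"
    proof
      assume "(2::'a) = 0"
      then have "of_nat 2 = (0::'a)"
        by simp
      then have "CHAR('a) dvd 2"
        by (simp only: of_nat_eq_0_iff_char_dvd)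
      then have "CHAR('a) \<in> {1, 2}"
        using dvd_imp_le[of "CHAR('a)" 2] by (cases "CHAR('a)") auto
      with that show False
        by auto
    qed
    interpret B: square_scaling "blocks f" block_disc "\<lambda>b. block_map f (b / 2)"
    proof
      show "blocks f \<noteq> {}"
        using f_mem by (auto simp: blocks_def ext_vertices_eq_cluster)
      show "block_map f (b / 2) \<in> extensional (blocks f)" for b
        by (simp add: block_map_def)
    qed (use two block_map[of "b / 2" for b] inj_on_block_disc block_disc_nz in auto)
    \<comment> \<open>Halving permutes the nonzero elements of K, so both parametrisations give the
      same set of maps.\<close>
    have maps: "{block_map f (b / 2) | b. b \<noteq> 0} = {block_map f b | b. b \<noteq> 0}"
    proof (intro equalityI subsetI)
      fix g
      assume "g \<in> {block_map f b | b. b \<noteq> 0}"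
      then obtain b where "g = block_map f (2 * b / 2)" "2 * b \<noteq> 0"
        using two by auto
      then show "g \<in> {block_map f (b / 2) | b. b \<noteq> 0}"
        by blast
    next
      fix g
      assume "g \<in> {block_map f (b / 2) | b. b \<noteq> 0}"
      then obtain b where "g = block_map f (b / 2)" "b / 2 \<noteq> 0"
        using two by auto
      then show "g \<in> {block_map f b | b. b \<noteq> 0}"
        by blast
    qed
    have "(\<Theta>, \<Theta>') \<in> parcs (block_graph f)"
      if mem: "\<Theta> \<in> blocks f" "\<Theta>' \<in> blocks f" for \<Theta> \<Theta>'
    proof -
      \<comment> \<open>The map with parameter \<open>k / 2\<close> scales the discriminant by
        \<open>k\<^sup>2\<close> and therefore hits \<Theta>'.\<close>
      obtain k where k: "k \<noteq> 0" "block_disc \<Theta>' = k\<^sup>2 * block_disc \<Theta>"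
        using block_disc_ratio_square[OF mem] .
      then have "\<Theta>' = block_map f (k / 2) \<Theta>"
        using B.F_eqI mem by metis
      moreover have "k / 2 \<noteq> 0"
        using k two by simp
      ultimately show ?thesis
        using mem(1) unfolding block_graph_def by auto
    qed
    then show ?thesis
      using B.subgroup_F B.square_group_iso unfolding maps by (simp add: block_graph_def)
  qed
  ultimately show ?thesis
    using inj_on_block_disc by (simp add: ext_vertices_eq_cluster)
qed

end
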